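(* Let $K$ be a field with $\mathrm{char}(K)=0$ and let $\mathcal{U}(osp(1,2))$ (the dispin algebra) be the $K$-algebra generated by $x,y,z$ subject to the relations $$yx=xy-x,\qquad zx=-xz+y,\qquad zy=yz-z.$$ Then the element $f=4x^2z^2-y^2-2xz-y$ is central in $\mathcal{U}(osp(1,2))$, and $K[f]\subseteq Z(\mathcal{U}(osp(1,2)))$.
   Context: The algebra is the quotient of the free associative $K$-algebra on $x,y,z$ by the stated relations. $Z(\cdot)$ denotes the center and $K[f]$ the $K$-subalgebra generated by $f$. *)

theory Defs
  imports "HOL.Vector_Spaces" "HOL-Library.Poly_Mapping"
begin

section \<open>Free associative algebras\<close>

text \<open>
  The type \<open>'a word\<close> is the free monoid on \<open>'a\<close>. It is written additively only because
  \<^theory>\<open>HOL-Library.Poly_Mapping\<close> forms the monoid algebra of additive monoids, with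
  convolution as product; \<open>'a word \<Rightarrow>\<^sub>0 'k\<close> is thus the free associative unital \<open>'k\<close>-algebra
  on \<open>'a\<close>.
\<close>

datatype 'a word = Word (letters: "'a list")

instantiation word :: (type) monoid_add
begin

definition zero_word :: "'a word" where "0 = Word []"

definition plus_word :: "'a word \<Rightarrow> 'a word \<Rightarrow> 'a word" where
  "u + v = Word (letters u @ letters v)"

instance
  by standard (simp_all add: zero_word_def plus_word_def)

end

type_synonym ('a, 'k) free_algebra = "'a word \<Rightarrow>\<^sub>0 'k"

definition free_gen :: "'a \<Rightarrow> ('a, 'k::field) free_algebra" where
  "free_gen a = Poly_Mapping.single (Word [a]) 1"

definition free_scalar :: "'k \<Rightarrow> ('a, 'k::field) free_algebra" where
  "free_scalar c = Poly_Mapping.single 0 c"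

lemma word_add_eq_0_iff: "u + v = 0 \<longleftrightarrow> u = 0 \<and> v = (0::'a word)"
  by (cases u; cases v) (auto simp: zero_word_def plus_word_def)

lemma lookup_free_gen_0: "Poly_Mapping.lookup (free_gen a) 0 = 0"
  by (simp add: free_gen_def lookup_single zero_word_def)

lemma lookup_mult_0:
  fixes p q :: "('a, 'k::field) free_algebra"
  shows "Poly_Mapping.lookup (p * q) 0 = Poly_Mapping.lookup p 0 * Poly_Mapping.lookup q 0"
proof -
  have "Sum_any (\<lambda>v. Poly_Mapping.lookup q v when 0 = u + v) = (Poly_Mapping.lookup q 0 when u = 0)" for u
  proof (cases "u = 0")
    case True
    then have "(\<lambda>v. Poly_Mapping.lookup q v when 0 = u + v) = (\<lambda>v. Poly_Mapping.lookup q v when v = 0)"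
      by auto
    then show ?thesis using True by simp
  next
    case False
    then have "0 \<noteq> u + v" for v by (metis word_add_eq_0_iff)
    then show ?thesis using False by simp
  qed
  then have "Poly_Mapping.lookup (p * q) 0 = Sum_any (\<lambda>u. Poly_Mapping.lookup p u * Poly_Mapping.lookup q 0 when u = 0)"
    by (simp add: lookup_mult mult_when)
  then show ?thesis by simp
qed

lemma free_scalar_central: "free_scalar c * p = p * free_scalar c"
proof (rule poly_mapping_eqI)
  fix w
  have "Poly_Mapping.lookup (free_scalar c * p) w = c * Poly_Mapping.lookup p w"
    by (simp add: free_scalar_def lookup_mult lookup_single when_mult)
  moreover have "Poly_Mapping.lookup (p * free_scalar c) w = Poly_Mapping.lookup p w * c"
  proof -
    have "Sum_any (\<lambda>q. (c when 0 = q) when w = l + q) = (c when l = w)" for l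
    proof -
      have "(\<lambda>q. (c when 0 = q) when w = l + q) = (\<lambda>q. (c when l = w) when q = 0)"
        by (auto simp: when_def)
      then show ?thesis by (simp only: Sum_any_when_equal)
    qed
    then show ?thesis
      by (simp add: free_scalar_def lookup_mult lookup_single mult_when)
  qed
  ultimately show "Poly_Mapping.lookup (free_scalar c * p) w = Poly_Mapping.lookup (p * free_scalar c) w"
    by simp
qed


section \<open>Two-sided ideals and the centre\<close>

definition two_sided_ideal :: "'r::ring_1 set \<Rightarrow> bool" where
  "two_sided_ideal I \<longleftrightarrow>
     0 \<in> I \<and> (\<forall>a\<in>I. \<forall>b\<in>I. a + b \<in> I) \<and> (\<forall>r. \<forall>a\<in>I. r * a \<in> I \<and> a * r \<in> I)"

definition ring_center :: "'r::ring_1 set" where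
  "ring_center = {c. \<forall>a. c * a = a * c}"

lemma two_sided_ideal_hull: "two_sided_ideal (two_sided_ideal hull R)"
  by (rule hull_in) (auto simp: two_sided_ideal_def)

lemma two_sided_ideal_uminus: "two_sided_ideal I \<Longrightarrow> a \<in> I \<Longrightarrow> - a \<in> I"
  unfolding two_sided_ideal_def by (metis mult_minus1)


section \<open>The dispin algebra\<close>

datatype xyz = X | Y | Z

definition dispin_relators :: "(xyz, 'k::field) free_algebra set" where
  "dispin_relators =
    (let x = free_gen X; y = free_gen Y; z = free_gen Z in
      {y * x - (x * y - x), z * x - (- (x * z) + y), z * y - (y * z - z)})"

definition dispin_ideal :: "(xyz, 'k::field) free_algebra set" where
  "dispin_ideal = two_sided_ideal hull dispin_relators"

definition dispin_cong :: "(xyz, 'k::field) free_algebra \<Rightarrow> (xyz, 'k) free_algebra \<Rightarrow> bool" where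
  "dispin_cong p q \<longleftrightarrow> p - q \<in> dispin_ideal"

lemma dispin_ideal_zero: "0 \<in> dispin_ideal"
  and dispin_ideal_add: "a \<in> dispin_ideal \<Longrightarrow> b \<in> dispin_ideal \<Longrightarrow> a + b \<in> dispin_ideal"
  and dispin_ideal_uminus: "a \<in> dispin_ideal \<Longrightarrow> - a \<in> dispin_ideal"
  and dispin_ideal_left: "a \<in> dispin_ideal \<Longrightarrow> r * a \<in> dispin_ideal"
  and dispin_ideal_right: "a \<in> dispin_ideal \<Longrightarrow> a * r \<in> dispin_ideal"
  using two_sided_ideal_hull[of dispin_relators] two_sided_ideal_uminus[of dispin_ideal]
  by (auto simp: dispin_ideal_def two_sided_ideal_def)

lemma dispin_ideal_relators: "dispin_relators \<subseteq> dispin_ideal"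
  unfolding dispin_ideal_def by (rule hull_subset)

lemma dispin_cong_equivp: "equivp (dispin_cong :: (xyz, 'k::field) free_algebra \<Rightarrow> _)"
proof (rule equivpI)
  show "reflp (dispin_cong :: (xyz, 'k) free_algebra \<Rightarrow> _)"
    by (simp add: reflp_def dispin_cong_def dispin_ideal_zero)
  show "symp (dispin_cong :: (xyz, 'k) free_algebra \<Rightarrow> _)"
    unfolding symp_def dispin_cong_def by (metis dispin_ideal_uminus minus_diff_eq)
  show "transp (dispin_cong :: (xyz, 'k) free_algebra \<Rightarrow> _)"
  proof (rule transpI)
    fix p q r :: "(xyz, 'k) free_algebra"
    assume "dispin_cong p q" "dispin_cong q r"
    moreover have "p - r = (p - q) + (q - r)" by simp
    ultimately show "dispin_cong p r"
      unfolding dispin_cong_def by (simp only: dispin_ideal_add)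
  qed
qed

quotient_type (overloaded) 'k dispin = "(xyz, 'k::field) free_algebra" / dispin_cong
  by (rule dispin_cong_equivp)

text \<open>All relators have zero constant term, hence \<open>1\<close> is not in the ideal.\<close>

lemma one_notin_dispin_ideal: "1 \<notin> (dispin_ideal :: (xyz, 'k::field) free_algebra set)"
proof -
  let ?I = "{p :: (xyz, 'k) free_algebra. Poly_Mapping.lookup p 0 = 0}"
  have "two_sided_ideal ?I"
    by (simp add: two_sided_ideal_def lookup_add lookup_mult_0)
  moreover have "dispin_relators \<subseteq> ?I"
    by (auto simp: dispin_relators_def Let_def lookup_add lookup_minus lookup_mult_0
        lookup_free_gen_0)
  ultimately have "dispin_ideal \<subseteq> ?I"
    unfolding dispin_ideal_def by (rule hull_minimal[rotated])
  then show ?thesis by auto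
qed

instantiation dispin :: (field) ring_1
begin

lift_definition zero_dispin :: "'a dispin" is 0 .
lift_definition one_dispin :: "'a dispin" is 1 .

lift_definition plus_dispin :: "'a dispin \<Rightarrow> 'a dispin \<Rightarrow> 'a dispin" is "(+)"
proof -
  fix p p' q q' :: "(xyz, 'a) free_algebra"
  assume "dispin_cong p p'" "dispin_cong q q'"
  moreover have "(p + q) - (p' + q') = (p - p') + (q - q')" by simp
  ultimately show "dispin_cong (p + q) (p' + q')"
    unfolding dispin_cong_def by (metis dispin_ideal_add)
qed

lift_definition uminus_dispin :: "'a dispin \<Rightarrow> 'a dispin" is uminus
proof -
  fix p p' :: "(xyz, 'a) free_algebra"
  assume "dispin_cong p p'"
  moreover have "- p - - p' = - (p - p')" by simp
  ultimately show "dispin_cong (- p) (- p')"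
    unfolding dispin_cong_def by (metis dispin_ideal_uminus)
qed

lift_definition minus_dispin :: "'a dispin \<Rightarrow> 'a dispin \<Rightarrow> 'a dispin" is "(-)"
proof -
  fix p p' q q' :: "(xyz, 'a) free_algebra"
  assume "dispin_cong p p'" "dispin_cong q q'"
  moreover have "(p - q) - (p' - q') = (p - p') + - (q - q')" by simp
  ultimately show "dispin_cong (p - q) (p' - q')"
    unfolding dispin_cong_def by (metis dispin_ideal_add dispin_ideal_uminus)
qed

lift_definition times_dispin :: "'a dispin \<Rightarrow> 'a dispin \<Rightarrow> 'a dispin" is "(*)"
proof -
  fix p p' q q' :: "(xyz, 'a) free_algebra"
  assume "dispin_cong p p'" "dispin_cong q q'"
  moreover have "p * q - p' * q' = (p - p') * q + p' * (q - q')"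
    by (simp add: algebra_simps)
  ultimately show "dispin_cong (p * q) (p' * q')"
    unfolding dispin_cong_def
    by (metis dispin_ideal_add dispin_ideal_left dispin_ideal_right)
qed

instance
proof
  show "(0::'a dispin) \<noteq> 1"
    by transfer
      (metis dispin_cong_def diff_0 dispin_ideal_uminus minus_minus one_notin_dispin_ideal)
qed (transfer; simp add: dispin_cong_def algebra_simps dispin_ideal_zero)+

end

lift_definition dispin_scale :: "'k::field \<Rightarrow> 'k dispin \<Rightarrow> 'k dispin"
  is "\<lambda>c p. free_scalar c * p"
  unfolding dispin_cong_def by (metis dispin_ideal_left right_diff_distrib)

interpretation dispin: vector_space "dispin_scale :: 'k::field \<Rightarrow> 'k dispin \<Rightarrow> 'k dispin"
proof
  fix a b :: 'k and v w :: "'k dispin"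
  show "dispin_scale a (v + w) = dispin_scale a v + dispin_scale a w"
    by transfer (simp add: dispin_cong_def dispin_ideal_zero distrib_left)
  show "dispin_scale (a + b) v = dispin_scale a v + dispin_scale b v"
    by transfer
      (simp add: dispin_cong_def dispin_ideal_zero distrib_right free_scalar_def single_add)
  show "dispin_scale a (dispin_scale b v) = dispin_scale (a * b) v"
    by transfer
      (simp add: dispin_cong_def dispin_ideal_zero free_scalar_def mult_single flip: mult.assoc)
  show "dispin_scale 1 v = v"
    by transfer (simp add: dispin_cong_def dispin_ideal_zero free_scalar_def)
qed

lemma dispin_scale_mult_left: "dispin_scale c (a * b) = dispin_scale c a * b"
  by transfer (simp add: dispin_cong_def dispin_ideal_zero mult.assoc)

lemma dispin_scale_mult_right: "dispin_scale c (a * b) = a * dispin_scale c b"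
proof transfer
  fix c :: 'a and a b :: "(xyz, 'a) free_algebra"
  have "free_scalar c * (a * b) = a * (free_scalar c * b)"
    by (metis free_scalar_central mult.assoc)
  then show "dispin_cong (free_scalar c * (a * b)) (a * (free_scalar c * b))"
    by (simp add: dispin_cong_def dispin_ideal_zero)
qed

lift_definition dispin_x :: "'k::field dispin" is "free_gen X" .
lift_definition dispin_y :: "'k::field dispin" is "free_gen Y" .
lift_definition dispin_z :: "'k::field dispin" is "free_gen Z" .

lemma dispin_relations:
  "dispin_y * dispin_x = dispin_x * dispin_y - (dispin_x :: 'k::field dispin)"
  "dispin_z * dispin_x = - (dispin_x * dispin_z) + (dispin_y :: 'k dispin)"
  "dispin_z * dispin_y = dispin_y * dispin_z - (dispin_z :: 'k dispin)"
proof -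
  let ?x = "free_gen X :: (xyz, 'k) free_algebra"
    and ?y = "free_gen Y :: (xyz, 'k) free_algebra"
    and ?z = "free_gen Z :: (xyz, 'k) free_algebra"
  have c: "dispin_cong (?y * ?x) (?x * ?y - ?x)" "dispin_cong (?z * ?x) (- (?x * ?z) + ?y)"
    "dispin_cong (?z * ?y) (?y * ?z - ?z)"
    unfolding dispin_cong_def
    by (rule subsetD[OF dispin_ideal_relators]; simp add: dispin_relators_def Let_def)+
  show "dispin_y * dispin_x = dispin_x * dispin_y - (dispin_x :: 'k dispin)"
    using c(1) by transfer
  show "dispin_z * dispin_x = - (dispin_x * dispin_z) + (dispin_y :: 'k dispin)"
    using c(2) by transfer
  show "dispin_z * dispin_y = dispin_y * dispin_z - (dispin_z :: 'k dispin)"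
    using c(3) by transfer
qed

definition dispin_subalgebra :: "'k::field dispin set \<Rightarrow> bool" where
  "dispin_subalgebra S \<longleftrightarrow>
     dispin.subspace S \<and> 1 \<in> S \<and> (\<forall>a\<in>S. \<forall>b\<in>S. a * b \<in> S)"

text \<open>\<open>dispin_adjoin f\<close> is \<open>K[f]\<close>, the smallest unital \<open>K\<close>-subalgebra containing \<open>f\<close>.\<close>

definition dispin_adjoin :: "'k::field dispin \<Rightarrow> 'k dispin set" where
  "dispin_adjoin f = dispin_subalgebra hull {f}"

end

theory Submission
  imports Defs
begin

text \<open>
  Straightening words to the form \<open>x\<^sup>i y\<^sup>j z\<^sup>k\<close> gives \<open>f g = g f\<close> for each generator \<open>g\<close>:
  the essential commutations are \<open>z\<^sup>2 x = x z\<^sup>2 - z\<close> and \<open>z x\<^sup>2 = x\<^sup>2 z - x\<close>, and \<open>y\<close> commutes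
  with \<open>x z\<close>. The commutant of \<open>f\<close> is thus a subalgebra containing the generators, hence is
  everything; and the centre is a subalgebra containing \<open>f\<close>, hence contains \<open>K[f]\<close>.
\<close>

lemma dispin_subalgebra_commutant: "dispin_subalgebra {a. a * b = b * a}"
proof -
  have "u * v * b = b * (u * v)" if "u * b = b * u" "v * b = b * v" for u v
    using that by (metis mult.assoc)
  then show ?thesis
    unfolding dispin_subalgebra_def dispin.subspace_def
    by (auto simp: distrib_left distrib_right
        simp flip: dispin_scale_mult_left dispin_scale_mult_right)
qed

lemma dispin_subalgebra_Inter:
  assumes "\<And>S. S \<in> \<S> \<Longrightarrow> dispin_subalgebra S"
  shows "dispin_subalgebra (\<Inter>\<S>)"
  using assms unfolding dispin_subalgebra_def dispin.subspace_def by blast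

text \<open>The centre is the intersection of the commutants of all elements.\<close>

lemma dispin_subalgebra_center: "dispin_subalgebra (ring_center :: 'k::field dispin set)"
proof -
  have "ring_center = (\<Inter>b. {a :: 'k dispin. a * b = b * a})"
    unfolding ring_center_def by blast
  then show ?thesis
    using dispin_subalgebra_Inter[of "range (\<lambda>b. {a :: 'k dispin. a * b = b * a})"]
      dispin_subalgebra_commutant by auto
qed

text \<open>Every class has a representative in the free algebra, a finite sum of scalar multiples
  of words, and words are products of generators.\<close>

lemma dispin_generated:
  fixes S :: "'k::field dispin set"
  assumes S: "dispin_subalgebra S" and gens: "dispin_x \<in> S" "dispin_y \<in> S" "dispin_z \<in> S"
  shows "a \<in> S"
proof -
  have add: "u + v \<in> S" and mult: "u * v \<in> S" if "u \<in> S" "v \<in> S" for u v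
    using S that by (auto simp: dispin_subalgebra_def dispin.subspace_def)
  have scalar: "abs_dispin (free_scalar c) \<in> S" for c
  proof -
    have "dispin_scale c 1 \<in> S"
      using S by (auto simp: dispin_subalgebra_def dispin.subspace_def)
    then show ?thesis
      by (simp add: dispin_scale.abs_eq one_dispin_def)
  qed
  have gen: "abs_dispin (free_gen g) \<in> S" for g
    using gens by (cases g) (simp_all add: dispin_x_def dispin_y_def dispin_z_def)
  have monomial: "abs_dispin (Poly_Mapping.single (Word l) c) \<in> S" for l c
  \<comment> \<open>The coefficient sits on the empty word; each letter is then multiplied on from
    the left.\<close>
  proof (induction l)
    case Nil
    then show ?case using scalar[of c] by (simp add: free_scalar_def zero_word_def)
  next
    case (Cons g l)
    have "Poly_Mapping.single (Word (g # l)) c = free_gen g * Poly_Mapping.single (Word l) c"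
      by (simp add: free_gen_def mult_single plus_word_def)
    then show ?case
      using mult[OF gen[of g] Cons.IH] by (simp add: times_dispin.abs_eq)
  qed
  have "abs_dispin p \<in> S" for p
  proof (induction p rule: update_induct)
    case const
    then show ?case
      using S by (simp add: dispin_subalgebra_def dispin.subspace_def flip: zero_dispin_def)
  next
    case (update p w c)
    \<comment> \<open>The induction only updates a key \<open>w\<close> outside the support of
      \<open>p\<close>, so nothing is overwritten and the update is a sum.\<close>
    then have "Poly_Mapping.update w c p = Poly_Mapping.single w c + p"
      by (intro poly_mapping_eqI)
        (auto simp: lookup_update lookup_add lookup_single in_keys_iff when_def)
    moreover have "abs_dispin (Poly_Mapping.single w c) \<in> S"
      by (cases w) (simp add: monomial)
    ultimately show ?case
      using update.IH by (simp add: add flip: plus_dispin.abs_eq)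
  qed
  then show ?thesis
    by (metis Quotient3_abs_rep Quotient3_dispin)
qed

text \<open>Read from left to right, the relations move \<open>x\<close> to the left and
  \<open>z\<close> to the right, which brings both products to the same ordered form.\<close>

lemma osp_casimir_commutes:
  fixes x y z :: "'r::ring_1"
  assumes yx: "y * x = x * y - x" and zx: "z * x = - (x * z) + y" and zy: "z * y = y * z - z"
  defines "f \<equiv> 4 * x^2 * z^2 - y^2 - 2 * x * z - y"
  shows "f * x = x * f" and "f * y = y * f" and "f * z = z * f"
proof -
  \<comment> \<open>The relations times an arbitrary right factor, to apply inside products nested
    to the right.\<close>
  have assoc: "y * (x * a) = x * (y * a) - x * a" "z * (x * a) = - (x * (z * a)) + y * a"
    "z * (y * a) = y * (z * a) - z * a" for a
    by (simp_all add: yx zx zy left_diff_distrib distrib_right flip: mult.assoc)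
  \<comment> \<open>As repeated sums, the coefficients do not separate letters, and terms cancel
    additively.\<close>
  have num: "2 * a = a + a" "4 * a = a + a + a + a" for a :: 'r
  proof -
    have "(2 :: 'r) = 1 + 1" "(4 :: 'r) = 1 + 1 + 1 + 1" by simp_all
    then show "2 * a = a + a" "4 * a = a + a + a + a"
      by (simp_all only: distrib_right mult_1_left)
  qed
  have f: "f = 4 * (x * x * z * z) - y * y - 2 * (x * z) - y"
    by (simp add: f_def power2_eq_square mult.assoc)
  show "f * x = x * f" and "f * y = y * f" and "f * z = z * f"
    by (simp_all add: f num yx zx zy assoc algebra_simps)
qed

theorem theorem3p6:
  fixes x y z f :: "'k::field_char_0 dispin"
  assumes "x = dispin_x" and "y = dispin_y" and "z = dispin_z"
    and "f = 4 * x^2 * z^2 - y^2 - 2 * x * z - y"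
  shows "f \<in> ring_center \<and> dispin_adjoin f \<subseteq> ring_center"
proof
  have comm: "f * x = x * f" "f * y = y * f" "f * z = z * f"
    unfolding assms by (rule osp_casimir_commutes[OF dispin_relations])+
  have gens: "dispin_x \<in> {a. a * f = f * a}" "dispin_y \<in> {a. a * f = f * a}"
    "dispin_z \<in> {a. a * f = f * a}"
    unfolding assms(1-3)[symmetric] mem_Collect_eq by (rule comm[symmetric])+
  have "a \<in> {a. a * f = f * a}" for a
    by (rule dispin_generated[OF dispin_subalgebra_commutant gens])
  then have "f * a = a * f" for a
    unfolding mem_Collect_eq by (rule sym)
  then show center: "f \<in> ring_center"
    unfolding ring_center_def mem_Collect_eq by (rule allI)
  show "dispin_adjoin f \<subseteq> ring_center"
    unfolding dispin_adjoin_def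
  proof (rule hull_minimal)
    show "{f} \<subseteq> ring_center"
      using center by (rule insert_subsetI) (rule empty_subsetI)
  qed (rule dispin_subalgebra_center)
qed

end
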